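(* Let $N,n\ge 1$ and let $\{\mathbf{M}_i^0\}_{i=1}^N$ be pairwise commuting real symmetric $n\times n$ matrices. Let $\{\mathbf{v}_\alpha\}_{\alpha=1}^n$ be a common orthonormal eigenbasis, and let $\lambda_i^\alpha$ be the eigenvalues of $\mathbf{M}_i^0$, labelled so that $\mathbf{M}_i^0\mathbf{v}_\alpha=\lambda_i^\alpha\mathbf{v}_\alpha$ for $\alpha\in\{1,\dots,n\}$. Let $\boldsymbol{\mathcal{L}}$ be the linear operator on the space of $N$-tuples $\tilde{\mathbf{M}}=(\tilde{\mathbf{M}}_1,\dots,\tilde{\mathbf{M}}_N)$ of real symmetric $n\times n$ matrices (isomorphic to $\mathbb{R}^{N\frac{n(n+1)}{2}}$) given by $$(\boldsymbol{\mathcal{L}}\tilde{\mathbf{M}})_i=\sum_{j=1}^N\Big([\mathbf{M}_j^0,[\tilde{\mathbf{M}}_i,\mathbf{M}_j^0]]+[\mathbf{M}_j^0,[\mathbf{M}_i^0,\tilde{\mathbf{M}}_j]]\Big),\qquad i=1,\dots,N.$$ Then the eigenvalues of $\boldsymbol{\mathcal{L}}$, listed with multiplicity (multiplicities being added whenever listed values coincide), are $$0\quad\text{with multiplicity } nN+\frac{n(n-1)}{2},$$ $$-\sum_{j=1}^N(\lambda_j^\alpha-\lambda_j^\beta)^2\quad\text{with multiplicity } N-1,\ \text{ for each pair } \alpha,\beta\in\{1,\dots,n\},\ \alpha>\beta.$$ So generically (namely, when the numbers $\sum_{j=1}^N(\lambda_j^\alpha-\lambda_j^\beta)^2$, $\alpha>\beta$,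 are nonzero and pairwise distinct) $\boldsymbol{\mathcal{L}}$ has a kernel of dimension $nN+\frac{n(n-1)}{2}$ and $\frac{n(n-1)}{2}$ negative eigenvalues, each of multiplicity $N-1$.
   Context: $[\mathbf{A},\mathbf{B}]=\mathbf{A}\mathbf{B}-\mathbf{B}\mathbf{A}$ denotes the matrix commutator. The operator $\boldsymbol{\mathcal{L}}$ is the linearization, about the fixed point $(\mathbf{M}_1^0,\dots,\mathbf{M}_N^0)$, of the flow $\frac{d\mathbf{M}_i}{dt}=\sum_{j=1}^N[\mathbf{M}_j,[\mathbf{M}_i,\mathbf{M}_j]]$ on $N$-tuples of real symmetric $n\times n$ matrices. *)

theory Defs
  imports "Jordan_Normal_Form.Char_Poly" "HOL-Computational_Algebra.Fundamental_Theorem_Algebra"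
    "HOL-Analysis.Analysis"
begin

no_notation Matrix.vec_index (infixl \<open>$\<close> 100)
no_notation Matrix.scalar_prod (infix \<open>\<bullet>\<close> 70)
hide_const (open) Matrix.mat Matrix.vec Matrix.row Matrix.col Matrix.transpose_mat
  Determinant.det

section \<open>Eigenvalues of a linear operator on a finite-dimensional subspace\<close>

definition ordered_basis :: "'a::real_vector list \<Rightarrow> 'a set \<Rightarrow> bool"
  where "ordered_basis bs S \<longleftrightarrow> distinct bs \<and> independent (set bs) \<and> span (set bs) = S"

definition matrix_wrt :: "'a::real_vector list \<Rightarrow> ('a \<Rightarrow> 'a) \<Rightarrow> real Matrix.mat"
  where "matrix_wrt bs T =
    Matrix.mat (length bs) (length bs) (\<lambda>(i, j). representation (set bs) (T (bs ! j)) (bs ! i))"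

text \<open>The value does not depend on the chosen basis; see \<open>charpoly_on_eq\<close> below.\<close>

definition charpoly_on :: "'a::real_vector set \<Rightarrow> ('a \<Rightarrow> 'a) \<Rightarrow> real poly"
  where "charpoly_on S T = char_poly (matrix_wrt (SOME bs. ordered_basis bs S) T)"

text \<open>All complex roots of the characteristic polynomial, each counted with its algebraic
  multiplicity.\<close>

definition eigenvalues_on :: "'a::real_vector set \<Rightarrow> ('a \<Rightarrow> 'a) \<Rightarrow> complex multiset"
  where "eigenvalues_on S T = proots (map_poly of_real (charpoly_on S T))"

definition eigenspace_on :: "'a::real_vector set \<Rightarrow> ('a \<Rightarrow> 'a) \<Rightarrow> real \<Rightarrow> 'a set"
  where "eigenspace_on S T c = {x \<in> S. T x = c *\<^sub>R x}"

definition is_eigenvalue_on :: "'a::real_vector set \<Rightarrow> ('a \<Rightarrow> 'a) \<Rightarrow> real \<Rightarrow> bool"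
  where "is_eigenvalue_on S T c \<longleftrightarrow> (\<exists>x \<in> S. x \<noteq> 0 \<and> T x = c *\<^sub>R x)"

lemma ordered_basis_exists:
  fixes S :: "'a::euclidean_space set"
  assumes "subspace S"
  shows "\<exists>bs. ordered_basis bs S"
proof -
  obtain B where B: "B \<subseteq> S" "independent B" "S \<subseteq> span B"
    using basis_exists[of S] by metis
  then have "finite B" using independent_imp_finite by blast
  then obtain bs where "set bs = B" "distinct bs" using finite_distinct_list by blast
  moreover have "span B = S" using B assms by (simp add: span_subspace)
  ultimately show ?thesis using B unfolding ordered_basis_def by blast
qed

lemma ordered_basis_length_eq:
  assumes "ordered_basis bs S" "ordered_basis cs S"
  shows "length bs = length cs"
proof -
  have "dim S = card (set bs)" "dim S = card (set cs)"
    using assms dim_span_eq_card_independent[of "set bs"] dim_span_eq_card_independent[of "set cs"]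
    unfolding ordered_basis_def by metis+
  then show ?thesis using assms by (simp add: ordered_basis_def distinct_card)
qed

lemma ordered_basis_expand:
  assumes "ordered_basis bs S" "x \<in> S"
  shows "(\<Sum>k<length bs. representation (set bs) x (bs ! k) *\<^sub>R (bs ! k)) = x"
proof -
  have *: "distinct bs" "independent (set bs)" "x \<in> span (set bs)"
    using assms by (auto simp: ordered_basis_def)
  have "(\<Sum>k<length bs. representation (set bs) x (bs ! k) *\<^sub>R (bs ! k))
      = (\<Sum>b\<in>set bs. representation (set bs) x b *\<^sub>R b)"
    by (rule sum.reindex_bij_betw[OF bij_betw_nth]) (use * in auto)
  also have "\<dots> = x"
    using real_vector.sum_representation_eq[of "set bs" x "set bs"] * by simp
  finally show ?thesis .
qed

lemma representation_linear_sum: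
  assumes bs: "ordered_basis bs S" and cs: "ordered_basis cs S"
    and T: "linear T" "T ` S \<subseteq> S" and x: "x \<in> S"
  shows "representation (set cs) (T x) c =
    (\<Sum>k<length bs. representation (set cs) (T (bs ! k)) c * representation (set bs) x (bs ! k))"
proof -
  have ind: "independent (set cs)" and sp: "span (set cs) = S"
    using cs by (auto simp: ordered_basis_def)
  have mem: "bs ! k \<in> S" if "k < length bs" for k
    using bs that span_base[of "bs ! k" "set bs"] by (auto simp: ordered_basis_def)
  have "T x = T (\<Sum>k<length bs. representation (set bs) x (bs ! k) *\<^sub>R (bs ! k))"
    using ordered_basis_expand[OF bs x] by simp
  also have "\<dots> = (\<Sum>k<length bs. representation (set bs) x (bs ! k) *\<^sub>R T (bs ! k))"
    using T(1) by (simp add: linear_sum linear_cmul)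
  finally have Tx: "T x = (\<Sum>k<length bs. representation (set bs) x (bs ! k) *\<^sub>R T (bs ! k))" .
  have in_span: "T (bs ! k) \<in> span (set cs)" if "k < length bs" for k
    using mem[OF that] T(2) sp by auto
  have "representation (set cs) (T x) c
      = (\<Sum>k<length bs. representation (set cs) (representation (set bs) x (bs ! k) *\<^sub>R T (bs ! k)) c)"
    unfolding Tx using in_span
    by (subst real_vector.representation_sum[OF ind]) (auto intro: span_scale)
  also have "\<dots> = (\<Sum>k<length bs. representation (set cs) (T (bs ! k)) c *
      representation (set bs) x (bs ! k))"
    using in_span by (intro sum.cong) (auto simp: real_vector.representation_scale[OF ind])
  finally show ?thesis .
qed

lemma char_poly_matrix_wrt_eq:
  assumes bs: "ordered_basis bs S" and cs: "ordered_basis cs S"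
    and T: "linear T" "T ` S \<subseteq> S"
  shows "char_poly (matrix_wrt bs T) = char_poly (matrix_wrt cs T)"
proof -
  define n where "n = length bs"
  have n: "length bs = n" "length cs = n"
    using ordered_basis_length_eq[OF bs cs] by (simp_all add: n_def)
  define change where "change as ds =
    Matrix.mat n n (\<lambda>(i, j). representation (set as) (ds ! j) (as ! i))" for as ds :: "'a list"
  have mem: "as ! k \<in> S" if "ordered_basis as S" "k < length as" for as k
    using that span_base[of "as ! k" "set as"] by (auto simp: ordered_basis_def)
  have inv: "change as ds * change ds as = 1\<^sub>m n"
    if as: "ordered_basis as S" and ds: "ordered_basis ds S" and l: "length as = n" "length ds = n"
    for as ds
  proof (rule eq_matI)
    fix i j assume "i < dim_row (1\<^sub>m n :: real Matrix.mat)" "j < dim_col (1\<^sub>m n :: real Matrix.mat)"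
    then have ij: "i < n" "j < n" by auto
    have "(change as ds * change ds as) $$ (i, j) =
      (\<Sum>k<n. representation (set as) (ds ! k) (as ! i) * representation (set ds) (as ! j) (ds ! k))"
      using ij by (simp add: change_def Matrix.scalar_prod_def atLeast0LessThan)
    also have "\<dots> = representation (set as) (as ! j) (as ! i)"
      using representation_linear_sum[OF ds as linear_id _ mem[OF as], of j "as ! i"] ij l
      by simp
    also have "\<dots> = (if i = j then 1 else 0)"
      using as ij l by (subst real_vector.representation_basis)
        (auto simp: ordered_basis_def nth_eq_iff_index_eq)
    finally show "(change as ds * change ds as) $$ (i, j) = 1\<^sub>m n $$ (i, j)"
      using ij by simp
  qed (auto simp: change_def)
  have mult: "matrix_wrt bs T = change bs cs * matrix_wrt cs T * change cs bs"
  proof (rule eq_matI)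
    fix i j assume "i < dim_row (change bs cs * matrix_wrt cs T * change cs bs)"
      "j < dim_col (change bs cs * matrix_wrt cs T * change cs bs)"
    then have ij: "i < n" "j < n" by (auto simp: change_def)
    have Tm: "T (as ! k) \<in> S" if "ordered_basis as S" "k < length as" for as k
      using mem[OF that] T(2) by auto
    have A: "(change bs cs * matrix_wrt cs T) $$ (i, k) = representation (set bs) (T (cs ! k)) (bs ! i)"
      if "k < n" for k
    proof -
      have "(change bs cs * matrix_wrt cs T) $$ (i, k) =
        (\<Sum>l<n. representation (set bs) (cs ! l) (bs ! i) * representation (set cs) (T (cs ! k)) (cs ! l))"
        using ij that n by (simp add: change_def matrix_wrt_def Matrix.scalar_prod_def atLeast0LessThan)
      also have "\<dots> = representation (set bs) (T (cs ! k)) (bs ! i)"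
        using representation_linear_sum[OF cs bs linear_id _ Tm[OF cs], of k "bs ! i"] that n by simp
      finally show ?thesis .
    qed
    have "(change bs cs * matrix_wrt cs T * change cs bs) $$ (i, j) =
      (\<Sum>k<n. (change bs cs * matrix_wrt cs T) $$ (i, k) * representation (set cs) (bs ! j) (cs ! k))"
      using ij n
      by (simp add: change_def matrix_wrt_def Matrix.scalar_prod_def atLeast0LessThan)
    also have "\<dots> = (\<Sum>k<n. representation (set bs) (T (cs ! k)) (bs ! i) *
        representation (set cs) (bs ! j) (cs ! k))"
      using A by simp
    also have "\<dots> = representation (set bs) (T (bs ! j)) (bs ! i)"
      using representation_linear_sum[OF cs bs T mem[OF bs], of j "bs ! i"] ij n by simp
    finally show "matrix_wrt bs T $$ (i, j) =
        (change bs cs * matrix_wrt cs T * change cs bs) $$ (i, j)"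
      using ij n by (simp add: matrix_wrt_def)
  qed (auto simp: change_def matrix_wrt_def n)
  have "similar_mat (matrix_wrt bs T) (matrix_wrt cs T)"
    by (rule similar_matI[of _ _ "change bs cs" "change cs bs" n])
      (use inv[OF bs cs] inv[OF cs bs] mult n in \<open>auto simp: change_def matrix_wrt_def\<close>)
  then show ?thesis by (rule char_poly_similar)
qed

lemma charpoly_on_eq:
  assumes "ordered_basis bs S" "linear T" "T ` S \<subseteq> S"
  shows "charpoly_on S T = char_poly (matrix_wrt bs T)"
  unfolding charpoly_on_def
  by (rule char_poly_matrix_wrt_eq[OF someI[of "\<lambda>bs. ordered_basis bs S", OF assms(1)] assms])

section \<open>The linearized operator\<close>

definition commutator :: "real^'n^'n \<Rightarrow> real^'n^'n \<Rightarrow> real^'n^'n"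
  where "commutator A B = A ** B - B ** A"

definition symmetric_tuples :: "(real^'n^'n^'N) set"
  where "symmetric_tuples = {M. \<forall>i. transpose (M $ i) = M $ i}"

definition linearized_flow :: "real^'n^'n^'N \<Rightarrow> real^'n^'n^'N \<Rightarrow> real^'n^'n^'N"
  where "linearized_flow M0 M = (\<chi> i. \<Sum>j\<in>UNIV.
    commutator (M0 $ j) (commutator (M $ i) (M0 $ j)) +
    commutator (M0 $ j) (commutator (M0 $ i) (M $ j)))"

lemma subspace_symmetric_tuples: "subspace (symmetric_tuples :: (real^'n^'n^'N) set)"
  by (auto simp: subspace_def symmetric_tuples_def transpose_def vec_eq_iff)

lemma commutator_add_right: "commutator A (B + C) = commutator A B + commutator A C"
  and commutator_add_left: "commutator (B + C) A = commutator B A + commutator C A"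
  by (simp_all add: commutator_def vec_eq_iff matrix_matrix_mult_def sum.distrib algebra_simps)

lemma commutator_scaleR_right: "commutator A (c *\<^sub>R B) = c *\<^sub>R commutator A B"
  and commutator_scaleR_left: "commutator (c *\<^sub>R B) A = c *\<^sub>R commutator B A"
  by (simp_all add: commutator_def vec_eq_iff matrix_matrix_mult_def sum_distrib_left algebra_simps)

lemma linear_linearized_flow: "linear (linearized_flow M0)"
  by (rule linearI)
    (auto simp: linearized_flow_def vec_eq_iff commutator_add_right commutator_add_left
      commutator_scaleR_right commutator_scaleR_left sum.distrib sum_distrib_left algebra_simps)

lemma transpose_commutator: 
  fixes A B :: "real^'n^'n"
  shows "transpose (commutator A B) = commutator (transpose B) (transpose A)"
proof -
  have "transpose (X - Y) = transpose X - transpose Y" for X Y :: "real^'n^'n"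
    by (simp add: transpose_def vec_eq_iff)
  then show ?thesis by (simp add: commutator_def matrix_transpose_mul)
qed

lemma commutator_antisym: "commutator A B = - commutator B A"
  by (simp add: commutator_def)

lemma transpose_double_commutator:
  assumes "transpose A = A" "transpose B = B" "transpose C = C"
  shows "transpose (commutator A (commutator B C)) = commutator A (commutator B C)"
proof -
  have "transpose (commutator A (commutator B C)) = commutator (commutator C B) A"
    using assms by (simp add: transpose_commutator)
  also have "\<dots> = - commutator A (commutator C B)" by (rule commutator_antisym)
  also have "\<dots> = commutator A (commutator B C)"
    using commutator_scaleR_right[of A "-1" "commutator C B"] commutator_antisym[of B C] by simp
  finally show ?thesis .
qed

lemma linearized_flow_symmetric:
  fixes M0 :: "real^'n^'n^'N"
  assumes "M0 \<in> symmetric_tuples"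
  shows "linearized_flow M0 ` symmetric_tuples \<subseteq> symmetric_tuples"
proof -
  have add: "transpose (X + Y) = transpose X + transpose Y" for X Y :: "real^'n^'n"
    by (simp add: transpose_def vec_eq_iff)
  have sum: "transpose (\<Sum>j\<in>UNIV. f j) = (\<Sum>j\<in>UNIV. transpose (f j))" for f :: "'N \<Rightarrow> real^'n^'n"
    by (simp add: transpose_def vec_eq_iff)
  show ?thesis using assms
    by (auto simp: symmetric_tuples_def linearized_flow_def sum add transpose_double_commutator)
qed

end

theory Submission
  imports Defs
begin

text \<open>
  In the common eigenbasis everything decouples. For indices \<open>\<alpha> \<ge> \<beta>\<close> put
  \<open>E = v\<^sub>\<alpha> v\<^sub>\<beta>\<^sup>T + v\<^sub>\<beta> v\<^sub>\<alpha>\<^sup>T\<close> and let \<open>d\<close> be the vector with entries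
  \<open>d\<^sub>j = \<lambda>\<^sub>j\<^sup>\<alpha> - \<lambda>\<^sub>j\<^sup>\<beta>\<close>. Bracketing with the \<open>j\<close>-th matrix of the fixed point multiplies
  \<open>E\<close> by \<open>d\<^sub>j\<close> and turns it into its antisymmetric companion, and a second bracket turns that back
  into a multiple of \<open>E\<close>. Hence the \<open>N\<close>-dimensional space of tuples \<open>(w\<^sub>1 E, \<dots>, w\<^sub>N E)\<close> is
  invariant, and on it the operator acts by
  \<open>w \<mapsto> (d \<bullet> w) d - (d \<bullet> d) w\<close> (\<open>linearized_flow_tensor\<close>). This is \<open>- (d \<bullet> d)\<close> times the
  orthogonal projection with kernel spanned by \<open>d\<close>: it kills \<open>d\<close> and is the scalar
  \<open>- (d \<bullet> d) = - (\<Sum>j. (\<lambda>\<^sub>j\<^sup>\<alpha> - \<lambda>\<^sub>j\<^sup>\<beta>)\<^sup>2)\<close> on the hyperplane orthogonal to \<open>d\<close>.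

  So each pair \<open>\<alpha> > \<beta>\<close> contributes one zero and \<open>N - 1\<close> copies of the scalar, while each diagonal
  pair has \<open>d = 0\<close> and contributes \<open>N\<close> zeros. The spaces for different pairs are mutually orthogonal
  and together fill the symmetric tuples, so orthogonal bases adapted to \<open>d\<close> combine into one
  orthogonal eigenbasis of the whole space (\<open>linearized_flow_eigenbasis\<close>).
  Such a basis determines the spectrum with multiplicities, and makes algebraic and geometric
  multiplicities agree (the locale \<open>orthogonal_eigenbasis\<close>); the rest is counting.
\<close>

section \<open>Orthogonal bases\<close>

text \<open>The component of \<open>x\<close> orthogonal to \<open>span B\<close> stays in \<open>S\<close>, so completeness kills it. This
  replaces a dimension count, which would need \<open>dim S\<close> in advance.\<close>

lemma span_eq_if_orthogonally_complete:
  fixes S B :: "'a::euclidean_space set"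
  assumes "subspace S" "B \<subseteq> S"
    and complete: "\<And>x. x \<in> S \<Longrightarrow> (\<And>b. b \<in> B \<Longrightarrow> x \<bullet> b = 0) \<Longrightarrow> x = 0"
  shows "span B = S"
proof
  show "span B \<subseteq> S" using assms(1,2) by (rule span_minimal[rotated])
  show "S \<subseteq> span B"
  proof
    fix x assume "x \<in> S"
    obtain y z where yz: "y \<in> span B" "\<And>w. w \<in> span B \<Longrightarrow> orthogonal z w" "x = y + z"
      using orthogonal_subspace_decomp_exists[of B x] by metis
    have "z = x - y" using yz by simp
    then have "z \<in> S" using \<open>x \<in> S\<close> \<open>span B \<subseteq> S\<close> yz(1) assms(1) by (auto intro: subspace_diff)
    moreover have "z \<bullet> b = 0" if "b \<in> B" for b
      using yz(2)[of b] span_base[OF that] by (simp add: orthogonal_def)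
    ultimately have "z = 0" by (rule complete)
    then show "x \<in> span B" using yz by simp
  qed
qed

text \<open>The basis is used to diagonalize \<open>w \<mapsto> (d \<bullet> w) d - (d \<bullet> d) w\<close>. Asking for
  \<open>d \<in> span {u}\<close> instead of \<open>d = u\<close> covers \<open>d = 0\<close>, where \<open>u\<close> can be any basis vector.\<close>

lemma orthogonal_basis_through:
  fixes d :: "'a::euclidean_space"
  shows "\<exists>u W. pairwise orthogonal W \<and> 0 \<notin> W \<and> span W = UNIV \<and> finite W \<and> card W = DIM('a)
    \<and> u \<in> W \<and> d \<in> span {u}"
proof -
  obtain b :: 'a where b: "b \<in> Basis" using nonempty_Basis by blast
  define u where "u = (if d = 0 then b else d)"
  have u: "u \<noteq> 0" "d \<in> span {u}"
    using b by (auto simp: u_def nonzero_Basis span_base span_zero)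
  obtain U where U: "U \<inter> insert 0 {u} = {}" "pairwise orthogonal ({u} \<union> U)"
      "span ({u} \<union> U) = span ({u} \<union> UNIV)"
    using orthogonal_extension_strong[of "{u}" UNIV] by (auto simp: pairwise_def)
  let ?W = "{u} \<union> U"
  have W: "0 \<notin> ?W" "span ?W = UNIV" using U u by auto
  then have "independent ?W" using U(2) pairwise_orthogonal_independent by blast
  then have "finite ?W" "card ?W = DIM('a)"
    using W(2) dim_span_eq_card_independent[of ?W] independent_imp_finite[of ?W] by simp_all
  then show ?thesis using U(2) W u(2) by (intro exI[of _ u] exI[of _ ?W]) auto
qed

section \<open>The spectrum of a diagonalizable operator\<close>

lemma sum_singleton_mset_const: "finite A \<Longrightarrow> (\<Sum>x\<in>A. {#c#}) = replicate_mset (card A) c"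
  by (induction A rule: finite_induct) auto

lemma count_sum_singleton_mset:
  "finite A \<Longrightarrow> count (\<Sum>x\<in>A. {#f x#}) c = card {x \<in> A. f x = c}"
  by (simp only: count_sum count_single card_eq_sum sum.inter_filter)

lemma map_poly_of_real_prod_linear:
  "map_poly of_real (\<Prod>a\<leftarrow>as. [:- a, 1:]) = (\<Prod>a\<leftarrow>as. [:- complex_of_real a, 1:])"
proof -
  interpret hom: map_poly_idom_hom "of_real :: real \<Rightarrow> complex" ..
  show ?thesis by (simp add: hom.hom_prod_list o_def map_poly_pCons)
qed

text \<open>The family is indexed so that equal eigenvalues keep separate indices, which turns
  multiplicities into cardinalities of index sets. Orthogonality gives both independence and
  injectivity of the family at once.\<close>

locale orthogonal_eigenbasis =
  fixes I :: "'i set" and e :: "'i \<Rightarrow> 'a::euclidean_space" and ev :: "'i \<Rightarrow> real"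
    and T :: "'a \<Rightarrow> 'a" and S :: "'a set"
  assumes finite_index: "finite I"
    and nonzero: "\<And>i. i \<in> I \<Longrightarrow> e i \<noteq> 0"
    and orthogonal: "\<And>i j. i \<in> I \<Longrightarrow> j \<in> I \<Longrightarrow> i \<noteq> j \<Longrightarrow> e i \<bullet> e j = 0"
    and span_eq: "span (e ` I) = S"
    and linear: "linear T"
    and eigenvector: "\<And>i. i \<in> I \<Longrightarrow> T (e i) = ev i *\<^sub>R e i"
begin

lemma inj: "inj_on e I"
  by (metis (no_types, lifting) inj_onI inner_eq_zero_iff nonzero orthogonal)

lemma independent_image: "independent (e ` J)" if J: "J \<subseteq> I"
proof (rule pairwise_orthogonal_independent)
  show "pairwise orthogonal (e ` J)"
    using J orthogonal by (fastforce simp: pairwise_def orthogonal_def)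
  show "0 \<notin> e ` J" using J nonzero by fastforce
qed

lemma dim_span_image: "J \<subseteq> I \<Longrightarrow> dim (span (e ` J)) = card J"
  using dim_span_eq_card_independent[OF independent_image] inj card_image inj_on_subset
  by metis

lemma dim_eq: "dim S = card I"
  using dim_span_image[of I] span_eq by simp

lemma invariant: "T ` S \<subseteq> S"
proof -
  have "T ` S = span (T ` e ` I)"
    using linear_span_image[OF linear] span_eq by metis
  also have "\<dots> \<subseteq> span (e ` I)"
    by (rule span_minimal) (auto simp: eigenvector span_base span_scale)
  finally show ?thesis by (simp add: span_eq)
qed

lemma expand:
  assumes "x \<in> S"
  obtains a where "x = (\<Sum>i\<in>I. a i *\<^sub>R e i)"
proof -
  obtain g where "x = (\<Sum>b\<in>e ` I. g b *\<^sub>R b)"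
    using assms span_eq span_finite[of "e ` I"] finite_index by auto
  then have "x = (\<Sum>i\<in>I. g (e i) *\<^sub>R e i)"
    by (simp add: sum.reindex[OF inj])
  then show thesis using that[of "g \<circ> e"] by simp
qed

lemma coefficients_zero:
  assumes "(\<Sum>i\<in>I. a i *\<^sub>R e i) = 0" "j \<in> I"
  shows "a j = 0"
proof -
  have "0 = (\<Sum>i\<in>I. a i *\<^sub>R e i) \<bullet> e j" using assms by simp
  also have "\<dots> = (\<Sum>i\<in>I. if i = j then a j * (e j \<bullet> e j) else 0)"
    by (auto simp: inner_sum_left orthogonal assms(2) intro!: sum.cong)
  also have "\<dots> = a j * (e j \<bullet> e j)" using assms(2) finite_index by simp
  finally show ?thesis using nonzero[OF assms(2)] by simp
qed

text \<open>In the basis listed by \<open>e\<close> the operator has a diagonal matrix, so the characteristic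
  polynomial is a product of linear factors \<open>X - ev i\<close>.\<close>

lemma eigenvalues_on_eq: "eigenvalues_on S T = (\<Sum>i\<in>I. {#of_real (ev i)#})"
proof -
  obtain ks where ks: "set ks = I" "distinct ks"
    using finite_distinct_list finite_index by blast
  let ?bs = "map e ks" and ?n = "length ks"
  have mem: "ks ! i \<in> I" if "i < ?n" for i using ks that by auto
  have ob: "ordered_basis ?bs S"
    using ks inj independent_image span_eq by (auto simp: ordered_basis_def distinct_map)
  have ent: "matrix_wrt ?bs T $$ (i, j) = (if i = j then ev (ks ! j) else 0)"
    if "i < ?n" "j < ?n" for i j
  proof -
    have "e (ks ! j) \<in> span (e ` I)" "e (ks ! j) \<in> e ` I"
      using mem[OF that(2)] by (auto intro: span_base)
    then show ?thesis
      using that ks mem inj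
      by (simp add: matrix_wrt_def eigenvector real_vector.representation_scale[OF independent_image]
          real_vector.representation_basis[OF independent_image] inj_on_eq_iff nth_eq_iff_index_eq)
  qed
  have carr: "matrix_wrt ?bs T \<in> carrier_mat ?n ?n" by (simp add: matrix_wrt_def)
  have diag: "diag_mat (matrix_wrt ?bs T) = map ev ks"
    using ent carr by (auto simp: diag_mat_def intro!: nth_equalityI)
  have "upper_triangular (matrix_wrt ?bs T)" using ent carr by (auto intro!: upper_triangularI)
  then have "charpoly_on S T = (\<Prod>a\<leftarrow>map ev ks. [:- a, 1:])"
    using char_poly_upper_triangular[OF carr] charpoly_on_eq[OF ob linear invariant] diag by simp
  then have "eigenvalues_on S T = proots (\<Prod>a\<leftarrow>map ev ks. [:- complex_of_real a, 1:])"
    by (simp only: eigenvalues_on_def map_poly_of_real_prod_linear)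
  also have "\<dots> = (\<Sum>a\<leftarrow>map ev ks. {#complex_of_real a#})"
    using proots_prod_list[of "map (\<lambda>i. [:- complex_of_real (ev i), 1:]) ks"]
    by (simp add: o_def image_iff)
  also have "\<dots> = (\<Sum>i\<in>I. {#of_real (ev i)#})"
    using sum_list_distinct_conv_sum_set[OF ks(2), of "\<lambda>i. {#complex_of_real (ev i)#}"] ks(1)
    by (simp add: o_def)
  finally show ?thesis .
qed

text \<open>Comparing coefficients in \<open>T x = c x\<close> shows that \<open>x\<close> has no component along a basis vector
  whose eigenvalue differs from \<open>c\<close>.\<close>

lemma eigenspace_on_eq: "eigenspace_on S T c = span (e ` {i \<in> I. ev i = c})"
proof
  show "span (e ` {i \<in> I. ev i = c}) \<subseteq> eigenspace_on S T c"
  proof (rule span_minimal)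
    show "e ` {i \<in> I. ev i = c} \<subseteq> eigenspace_on S T c"
      using eigenvector span_eq by (auto simp: eigenspace_on_def intro: span_base)
    show "subspace (eigenspace_on S T c)"
      using linear span_eq subspace_span[of "e ` I"]
      by (auto simp: subspace_def eigenspace_on_def linear_0 linear_add linear_cmul algebra_simps)
  qed
  show "eigenspace_on S T c \<subseteq> span (e ` {i \<in> I. ev i = c})"
  proof
    fix x assume "x \<in> eigenspace_on S T c"
    then have x: "x \<in> S" "T x = c *\<^sub>R x" by (auto simp: eigenspace_on_def)
    obtain a where a: "x = (\<Sum>i\<in>I. a i *\<^sub>R e i)" using expand[OF x(1)] by blast
    have "T x = (\<Sum>i\<in>I. (a i * ev i) *\<^sub>R e i)"
      by (simp add: a linear_sum[OF linear] linear_cmul[OF linear] eigenvector)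
    moreover have "c *\<^sub>R x = (\<Sum>i\<in>I. (a i * c) *\<^sub>R e i)"
      by (simp add: a scaleR_sum_right mult.commute)
    ultimately have "(\<Sum>i\<in>I. (a i * (ev i - c)) *\<^sub>R e i) = 0"
      using x(2) by (simp add: right_diff_distrib scaleR_diff_left sum_subtractf)
    then have "a i * (ev i - c) = 0" if "i \<in> I" for i using coefficients_zero[of "\<lambda>i. a i * (ev i - c)"] that by blast
    then have "a i = 0 \<or> ev i = c" if "i \<in> I" for i using that by fastforce
    then have "a i *\<^sub>R e i \<in> span (e ` {i \<in> I. ev i = c})" if "i \<in> I" for i
      using that by (metis (mono_tags, lifting) image_eqI mem_Collect_eq scaleR_zero_left
          span_base span_scale span_zero)
    then show "x \<in> span (e ` {i \<in> I. ev i = c})" unfolding a by (rule span_sum)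
  qed
qed

lemma dim_eigenspace_on: "dim (eigenspace_on S T c) = count (eigenvalues_on S T) (of_real c)"
  by (simp add: eigenspace_on_eq dim_span_image[OF Collect_restrict] eigenvalues_on_eq
      count_sum_singleton_mset finite_index del: dim_span)

lemma is_eigenvalue_on_iff: "is_eigenvalue_on S T c \<longleftrightarrow> of_real c \<in># eigenvalues_on S T"
proof -
  have "is_eigenvalue_on S T c \<longleftrightarrow> \<not> eigenspace_on S T c \<subseteq> {0}"
    by (auto simp: is_eigenvalue_on_def eigenspace_on_def)
  also have "\<dots> \<longleftrightarrow> dim (eigenspace_on S T c) > 0" by (simp add: dim_eq_0 flip: neq0_conv)
  finally show ?thesis by (simp add: dim_eigenspace_on)
qed

end

section \<open>The operator on one block\<close>

definition outer :: "real^'n \<Rightarrow> real^'n \<Rightarrow> real^'n^'n"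
  where "outer a b = (\<chi> i j. a $ i * b $ j)"

lemma inner_outer: "M \<bullet> outer a b = a \<bullet> (M *v b)"
  by (simp add: outer_def inner_vec_def matrix_vector_mult_def sum_distrib_left mult_ac)

lemma outer_mult_vec: "outer a b *v c = (b \<bullet> c) *\<^sub>R a"
  by (simp add: outer_def inner_vec_def matrix_vector_mult_def vec_eq_iff sum_distrib_left mult_ac)

lemma mult_outer: "A ** outer a b = outer (A *v a) b"
  by (simp add: outer_def matrix_matrix_mult_def matrix_vector_mult_def vec_eq_iff
      sum_distrib_left sum_distrib_right mult_ac)

lemma outer_mult: "outer a b ** A = outer a (transpose A *v b)"
  by (simp add: outer_def matrix_matrix_mult_def matrix_vector_mult_def vec_eq_iff
      transpose_def sum_distrib_left mult_ac)

lemma outer_scaleR: "outer (c *\<^sub>R a) b = c *\<^sub>R outer a b" "outer a (c *\<^sub>R b) = c *\<^sub>R outer a b"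
  by (simp_all add: outer_def vec_eq_iff)

definition sym_outer :: "real^'n \<Rightarrow> real^'n \<Rightarrow> real^'n^'n"
  where "sym_outer a b = outer a b + outer b a"

definition skew_outer :: "real^'n \<Rightarrow> real^'n \<Rightarrow> real^'n^'n"
  where "skew_outer a b = outer a b - outer b a"

lemma transpose_sym_outer: "transpose (sym_outer a b) = sym_outer a b"
  by (simp add: sym_outer_def outer_def transpose_def vec_eq_iff)

lemma inner_sym_outer:
  assumes "transpose M = M"
  shows "M \<bullet> sym_outer a b = 2 * (a \<bullet> (M *v b))"
proof -
  have "b \<bullet> (M *v a) = a \<bullet> (M *v b)"
    using assms dot_lmul_matrix[of b M a] by (metis inner_commute transpose_matrix_vector)
  then show ?thesis by (simp add: sym_outer_def inner_add_right inner_outer)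
qed

lemma sym_outer_inner_sym_outer:
  "sym_outer a b \<bullet> sym_outer c d = 2 * ((a \<bullet> c) * (b \<bullet> d) + (a \<bullet> d) * (b \<bullet> c))"
  by (simp add: inner_sym_outer[OF transpose_sym_outer])
    (simp add: sym_outer_def matrix_vector_mult_add_rdistrib outer_mult_vec inner_add_right
      inner_commute algebra_simps)

lemma commutator_minus_right: "commutator A (- B) = - commutator A B"
  using commutator_scaleR_right[of A "-1" B] by simp

text \<open>Since \<open>A\<close> is symmetric, it acts on either factor of \<open>outer a b\<close> through its eigenvalue, so the
  bracket multiplies \<open>outer a b\<close> by \<open>x - y\<close> and \<open>outer b a\<close> by \<open>y - x\<close>. The opposite signs exchange
  the symmetric and antisymmetric combinations, and two brackets give the factor \<open>(x - y)\<^sup>2\<close>.\<close>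

lemma commutator_eigenvectors:
  assumes "transpose A = A" "A *v a = x *\<^sub>R a" "A *v b = y *\<^sub>R b"
  shows "commutator A (sym_outer a b) = (x - y) *\<^sub>R skew_outer a b"
    and "commutator A (skew_outer a b) = (x - y) *\<^sub>R sym_outer a b"
proof -
  have outer: "commutator A (outer c d) = outer (A *v c) d - outer c (A *v d)" for c d
    by (simp add: commutator_def mult_outer outer_mult assms(1))
  have ab: "commutator A (outer a b) = (x - y) *\<^sub>R outer a b"
      "commutator A (outer b a) = - (x - y) *\<^sub>R outer b a"
    by (simp_all add: outer assms(2,3) outer_scaleR scaleR_diff_left)
  have diff: "commutator A (B - C) = commutator A B - commutator A C" for B C
    unfolding diff_conv_add_uminus commutator_add_right commutator_minus_right ..
  show "commutator A (sym_outer a b) = (x - y) *\<^sub>R skew_outer a b"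
    and "commutator A (skew_outer a b) = (x - y) *\<^sub>R sym_outer a b"
    unfolding sym_outer_def skew_outer_def commutator_add_right diff ab
    by (simp_all add: algebra_simps)
qed

definition tensor :: "real^'N \<Rightarrow> real^'n^'n \<Rightarrow> real^'n^'n^'N"
  where "tensor w E = (\<chi> i. w $ i *\<^sub>R E)"

lemma tensor_inner_tensor: "tensor w E \<bullet> tensor z F = (w \<bullet> z) * (E \<bullet> F)"
proof -
  have "tensor w E \<bullet> tensor z F = (\<Sum>i\<in>UNIV. (w $ i * z $ i) * (E \<bullet> F))"
    by (simp add: tensor_def inner_vec_def[of "\<chi> i. w $ i *\<^sub>R E"] mult_ac)
  also have "\<dots> = (w \<bullet> z) * (E \<bullet> F)" by (simp add: inner_vec_def[of w] sum_distrib_right)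
  finally show ?thesis .
qed

text \<open>A tuple orthogonal to \<open>tensor w E\<close> for all \<open>w\<close> in a spanning set is therefore orthogonal to
  \<open>E\<close> in every component.\<close>

lemma inner_tensor: "M \<bullet> tensor w E = w \<bullet> (\<chi> i. M $ i \<bullet> E)"
  by (simp add: tensor_def inner_vec_def[of M] inner_vec_def[of w])

lemma tensor_in_symmetric_tuples: "transpose E = E \<Longrightarrow> tensor w E \<in> symmetric_tuples"
  by (simp add: symmetric_tuples_def tensor_def transpose_def vec_eq_iff)

lemma tensor_scaleR: "tensor (c *\<^sub>R w) E = c *\<^sub>R tensor w E"
  by (simp add: tensor_def vec_eq_iff)

text \<open>The first double commutator contributes \<open>- d\<^sub>j\<^sup>2 w\<^sub>i\<close> and the second \<open>d\<^sub>j d\<^sub>i w\<^sub>j\<close>;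
  summing over \<open>j\<close> leaves the two inner products.\<close>

lemma linearized_flow_tensor:
  fixes M0 :: "real^'n^'n^'N"
  assumes sym: "\<And>i. transpose (M0 $ i) = M0 $ i"
    and a: "\<And>i. M0 $ i *v a = x $ i *\<^sub>R a" and b: "\<And>i. M0 $ i *v b = y $ i *\<^sub>R b"
  defines "d \<equiv> x - y"
  shows "linearized_flow M0 (tensor w (sym_outer a b)) =
    tensor ((d \<bullet> w) *\<^sub>R d - (d \<bullet> d) *\<^sub>R w) (sym_outer a b)"
proof -
  let ?E = "sym_outer a b"
  have c: "commutator (M0 $ j) ?E = d $ j *\<^sub>R skew_outer a b"
      "commutator (M0 $ j) (skew_outer a b) = d $ j *\<^sub>R ?E" for j
    using commutator_eigenvectors[OF sym a b, of j] by (simp_all add: d_def)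
  have c': "commutator ?E (M0 $ j) = - d $ j *\<^sub>R skew_outer a b" for j
    using commutator_antisym[of ?E] c(1)[of j] by simp
  have "linearized_flow M0 (tensor w ?E) $ i =
      ((d \<bullet> w) * d $ i - (d \<bullet> d) * w $ i) *\<^sub>R ?E" for i
  proof -
    have "linearized_flow M0 (tensor w ?E) $ i =
        (\<Sum>j\<in>UNIV. (d $ j * w $ j * d $ i - d $ j * d $ j * w $ i) *\<^sub>R ?E)"
      unfolding linearized_flow_def
      by (simp add: tensor_def commutator_scaleR_left commutator_scaleR_right commutator_minus_right c c'
          algebra_simps)
    also have "\<dots> = ((d \<bullet> w) * d $ i - (d \<bullet> d) * w $ i) *\<^sub>R ?E"
      by (simp add: inner_vec_def sum_distrib_right sum_subtractf flip: scaleR_sum_left)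
    finally show ?thesis .
  qed
  then show ?thesis by (simp add: vec_eq_iff tensor_def)
qed


section \<open>An eigenbasis for the linearized flow\<close>

lemma orthonormal_vectors_complete:
  fixes v :: "nat \<Rightarrow> 'a::euclidean_space"
  assumes orthonormal: "\<And>\<alpha> \<beta>. \<alpha> \<in> {1..DIM('a)} \<Longrightarrow> \<beta> \<in> {1..DIM('a)} \<Longrightarrow>
      v \<alpha> \<bullet> v \<beta> = (if \<alpha> = \<beta> then 1 else 0)"
    and zero: "\<And>\<alpha>. \<alpha> \<in> {1..DIM('a)} \<Longrightarrow> v \<alpha> \<bullet> x = 0"
  shows "x = 0"
proof -
  let ?B = "v ` {1..DIM('a)}"
  have "pairwise orthogonal ?B" using orthonormal by (force simp: pairwise_def orthogonal_def)
  moreover have "0 \<notin> ?B" using orthonormal by (metis imageE inner_zero_left zero_neq_one)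
  ultimately have ind: "independent ?B" by (rule pairwise_orthogonal_independent)
  have "inj_on v {1..DIM('a)}" by (metis (lifting) inj_onI orthonormal zero_neq_one)
  then have "card ?B = DIM('a)" by (simp add: card_image)
  then have "span ?B = UNIV"
    using card_ge_dim_independent[OF _ ind, of UNIV] by (auto simp: dim_UNIV)
  moreover have "orthogonal x b" if "b \<in> ?B" for b
    using zero that by (auto simp: orthogonal_def inner_commute[of x])
  ultimately have "orthogonal x x" using orthogonal_to_span[of x ?B x] by blast
  then show ?thesis by (simp add: orthogonal_self)
qed

text \<open>The eigenbasis is indexed by a pair \<open>p\<close> together with a vector from an orthogonal basis \<open>W p\<close>
  of the coefficient space, and \<open>u p \<in> W p\<close> is the member along the difference vector \<open>d\<close> of \<open>p\<close>.
  Diagonal pairs need no separate treatment: there \<open>gap p = 0\<close>, so both branches give the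
  eigenvalue 0.\<close>

lemma linearized_flow_eigenbasis:
  fixes M0 :: "real^'n^'n^'N" and v :: "nat \<Rightarrow> real^'n" and lam :: "'N \<Rightarrow> nat \<Rightarrow> real"
  defines "P \<equiv> {(\<alpha>, \<beta>). \<alpha> \<in> {1..CARD('n)} \<and> \<beta> \<in> {1..CARD('n)} \<and> \<alpha> \<ge> \<beta>}"
    and "gap \<equiv> (\<lambda>(\<alpha>, \<beta>). \<Sum>j\<in>UNIV. (lam j \<alpha> - lam j \<beta>)^2)"
  assumes symmetric: "\<And>i. transpose (M0 $ i) = M0 $ i"
    and orthonormal: "\<And>\<alpha> \<beta>. \<alpha> \<in> {1..CARD('n)} \<Longrightarrow> \<beta> \<in> {1..CARD('n)} \<Longrightarrow>
          v \<alpha> \<bullet> v \<beta> = (if \<alpha> = \<beta> then 1 else 0)"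
    and eigenbasis: "\<And>i \<alpha>. \<alpha> \<in> {1..CARD('n)} \<Longrightarrow> M0 $ i *v v \<alpha> = lam i \<alpha> *\<^sub>R v \<alpha>"
  shows "\<exists>u W. (\<forall>p. finite (W p) \<and> card (W p) = CARD('N) \<and> u p \<in> W p) \<and>
    orthogonal_eigenbasis (Sigma P W) (\<lambda>(p, w). tensor w (sym_outer (v (fst p)) (v (snd p))))
      (\<lambda>(p, w). if w = u p then 0 else - gap p) (linearized_flow M0) symmetric_tuples"
proof -
  define x where "x \<alpha> = (\<chi> i. lam i \<alpha>)" for \<alpha>
  define d where "d p = x (fst p) - x (snd p)" for p
  have gap: "gap p = d p \<bullet> d p" for p
    by (simp add: gap_def d_def x_def inner_vec_def power2_eq_square split: prod.split)
  obtain u W where W: "\<And>p. pairwise orthogonal (W p)" "\<And>p. 0 \<notin> W p" "\<And>p. span (W p) = UNIV"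
      "\<And>p. finite (W p)" "\<And>p. card (W p) = CARD('N)" "\<And>p. u p \<in> W p"
      and u: "\<And>p. d p \<in> span {u p}"
  proof -
    have "\<forall>p. \<exists>u W. pairwise orthogonal W \<and> 0 \<notin> W \<and> span W = UNIV \<and> finite W \<and> card W = CARD('N)
        \<and> u \<in> W \<and> d p \<in> span {u}"
      using orthogonal_basis_through[of "d _"] by simp
    then show ?thesis using that by metis
  qed
  define E where "E p = sym_outer (v (fst p)) (v (snd p))" for p
  define e where "e = (\<lambda>(p, w). tensor w (E p) :: real^'n^'n^'N)"
  \<comment> \<open>Restricting to \<open>\<alpha> \<ge> \<beta>\<close> makes the matrices pairwise orthogonal. The squared norm doubles on
    the diagonal, where both summands of \<open>sym_outer\<close> coincide.\<close>
  have EE: "E p \<bullet> E q = (if p = q then (if fst p = snd p then 4 else 2) else 0)"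
    if "p \<in> P" "q \<in> P" for p q
    using that by (auto simp: P_def E_def sym_outer_inner_sym_outer orthonormal split: if_splits)
  have "orthogonal_eigenbasis (Sigma P W) e
      (\<lambda>(p, w). if w = u p then 0 else - gap p) (linearized_flow M0) symmetric_tuples"
  proof (rule orthogonal_eigenbasis.intro)
    have "finite P" by (rule finite_subset[of _ "{1..CARD('n)} \<times> {1..CARD('n)}"]) (auto simp: P_def)
    then show "finite (Sigma P W)" using W(4) by blast
    show "linear (linearized_flow M0)" by (rule linear_linearized_flow)
  next
    fix i assume i: "i \<in> Sigma P W"
    then obtain p w where [simp]: "i = (p, w)" and pw: "p \<in> P" "w \<in> W p" by auto
    have "e i \<bullet> e i = (w \<bullet> w) * (E p \<bullet> E p)" by (simp add: e_def tensor_inner_tensor)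
    moreover have "w \<noteq> 0" using W(2) pw by metis
    ultimately have "e i \<bullet> e i \<noteq> 0" using EE[OF pw(1) pw(1)] by simp
    then show "e i \<noteq> 0" by auto
    have flow: "linearized_flow M0 (e i) = tensor ((d p \<bullet> w) *\<^sub>R d p - (d p \<bullet> d p) *\<^sub>R w) (E p)"
      unfolding e_def E_def d_def using pw(1)
      by (simp add: linearized_flow_tensor[OF symmetric, of _ "x (fst p)" _ "x (snd p)"]
          eigenbasis x_def P_def split_beta)
    obtain k where k: "d p = k *\<^sub>R u p" using u[of p] by (auto simp: span_singleton)
    show "linearized_flow M0 (e i) = (case i of (p, w) \<Rightarrow> if w = u p then 0 else - gap p) *\<^sub>R e i"
    proof (cases "w = u p")
      case True
      then have "(d p \<bullet> w) *\<^sub>R d p - (d p \<bullet> d p) *\<^sub>R w = 0" by (simp add: k)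
      then show ?thesis using True tensor_scaleR[of 0 0 "E p"] flow by simp
    next
      case False
      then have "d p \<bullet> w = 0"
        using W(1)[of p] W(6)[of p] pw(2) by (simp add: k pairwise_def orthogonal_def)
      then show ?thesis using False flow tensor_scaleR[of "- gap p" w "E p"] by (simp add: e_def gap)
    qed
  next
    fix i j assume "i \<in> Sigma P W" "j \<in> Sigma P W" "i \<noteq> j"
    moreover obtain p w q z where ij: "i = (p, w)" "j = (q, z)" by (cases i, cases j) simp
    ultimately have pq: "p \<in> P" "w \<in> W p" "q \<in> P" "z \<in> W q" "p = q \<Longrightarrow> w \<noteq> z" by auto
    have "w \<bullet> z = 0" if "p = q"
      using W(1)[of p] pq that by (auto simp: pairwise_def orthogonal_def)
    then show "e i \<bullet> e j = 0" using EE[OF pq(1,3)] by (simp add: ij e_def tensor_inner_tensor)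
  next
    show "span (e ` Sigma P W) = symmetric_tuples"
    proof (rule span_eq_if_orthogonally_complete)
      show "subspace (symmetric_tuples :: (real^'n^'n^'N) set)" by (rule subspace_symmetric_tuples)
      show "e ` Sigma P W \<subseteq> symmetric_tuples"
        by (auto simp: e_def E_def intro!: tensor_in_symmetric_tuples transpose_sym_outer)
      fix M :: "real^'n^'n^'N" assume M: "M \<in> symmetric_tuples"
        and ortho: "\<And>b. b \<in> e ` Sigma P W \<Longrightarrow> M \<bullet> b = 0"
      have sym: "transpose (M $ i) = M $ i" for i using M by (simp add: symmetric_tuples_def)
      \<comment> \<open>All matrix entries of \<open>M $ i\<close> in the eigenbasis vanish: first those with \<open>\<alpha> \<ge> \<beta>\<close> by
        orthogonality to the family, then the others by symmetry.\<close>
      have E0: "M $ i \<bullet> E p = 0" if "p \<in> P" for i p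
      proof -
        let ?m = "\<chi> i. M $ i \<bullet> E p"
        have "orthogonal ?m w" if "w \<in> W p" for w
        proof -
          have "e (p, w) \<in> e ` Sigma P W" using that \<open>p \<in> P\<close> by (intro imageI) auto
          then have "M \<bullet> e (p, w) = 0" by (rule ortho)
          then have "w \<bullet> ?m = 0" by (simp add: e_def inner_tensor)
          then show ?thesis by (simp only: orthogonal_def inner_commute[of ?m])
        qed
        then have "orthogonal ?m ?m" using orthogonal_to_span[of ?m "W p" ?m] W(3)[of p] by simp
        then show ?thesis by (simp add: orthogonal_self vec_eq_iff)
      qed
      have entry: "v \<alpha> \<bullet> (M $ i *v v \<beta>) = 0" if "\<alpha> \<in> {1..CARD('n)}" "\<beta> \<in> {1..CARD('n)}" for i \<alpha> \<beta>
      proof (cases "\<alpha> \<ge> \<beta>")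
        case True
        then show ?thesis using E0[of "(\<alpha>, \<beta>)" i] that by (simp add: P_def E_def inner_sym_outer[OF sym])
      next
        case False
        then have "M $ i \<bullet> sym_outer (v \<beta>) (v \<alpha>) = 0"
          using E0[of "(\<beta>, \<alpha>)" i] that by (simp add: P_def E_def)
        then have "M $ i \<bullet> sym_outer (v \<alpha>) (v \<beta>) = 0" by (simp add: sym_outer_def add.commute)
        then show ?thesis by (simp add: inner_sym_outer[OF sym])
      qed
      have "M $ i *v v \<beta> = 0" if "\<beta> \<in> {1..CARD('n)}" for i \<beta>
        by (rule orthonormal_vectors_complete[of v]) (use orthonormal entry that in auto)
      then have col: "v \<beta> \<bullet> (M $ i *v y) = 0" if "\<beta> \<in> {1..CARD('n)}" for i \<beta> y
        using that sym[of i] dot_lmul_matrix[of "v \<beta>" "M $ i" y]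
        by (metis inner_zero_left transpose_matrix_vector)
      have "M $ i *v y = 0" for i y
        by (rule orthonormal_vectors_complete[of v]) (use orthonormal col in auto)
      then have "M $ i = 0" for i by (simp add: matrix_eq)
      then show "M = 0" by (simp add: vec_eq_iff)
    qed
  qed
  then show ?thesis using W(4-6) unfolding e_def E_def by blast
qed

section \<open>Counting multiplicities\<close>

lemma card_index_pairs: "card {(\<alpha>, \<beta>). \<alpha> \<in> {1..n} \<and> \<beta> \<in> {1..n} \<and> \<alpha> > (\<beta>::nat)} = n * (n - 1) div 2"
proof -
  have "{(\<alpha>, \<beta>). \<alpha> \<in> {1..n} \<and> \<beta> \<in> {1..n} \<and> \<alpha> > \<beta>} = (SIGMA \<alpha>:{1..n}. {1..<\<alpha>})" by auto
  then have "card {(\<alpha>, \<beta>). \<alpha> \<in> {1..n} \<and> \<beta> \<in> {1..n} \<and> \<alpha> > \<beta>} = (\<Sum>\<alpha>=1..n. \<alpha> - 1)" by simp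
  also have "\<dots> = \<Sum>{0..<n}" by (rule sum.reindex_bij_witness[of _ Suc "\<lambda>\<alpha>. \<alpha> - 1"]) auto
  also have "\<dots> = n * (n - 1) div 2" by (simp add: Sum_Ico_nat)
  finally show ?thesis .
qed

theorem proposition3p2:
  fixes M0 :: "real^'n^'n^'N"
    and v :: "nat \<Rightarrow> real^'n"
    and lam :: "'N \<Rightarrow> nat \<Rightarrow> real"
  defines "n \<equiv> CARD('n)"
    and "N \<equiv> CARD('N)"
    and "S \<equiv> (symmetric_tuples :: (real^'n^'n^'N) set)"
    and "L \<equiv> linearized_flow M0"
    and "pairs \<equiv> {(\<alpha>, \<beta>). \<alpha> \<in> {1..CARD('n)} \<and> \<beta> \<in> {1..CARD('n)} \<and> \<alpha> > \<beta>}"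
    and "gap \<equiv> (\<lambda>(\<alpha>, \<beta>). \<Sum>j\<in>UNIV. (lam j \<alpha> - lam j \<beta>)^2)"
  assumes symmetric: "\<And>i. transpose (M0 $ i) = M0 $ i"
    and commuting: "\<And>i j. M0 $ i ** M0 $ j = M0 $ j ** M0 $ i"
    and orthonormal: "\<And>\<alpha> \<beta>. \<alpha> \<in> {1..n} \<Longrightarrow> \<beta> \<in> {1..n} \<Longrightarrow>
          v \<alpha> \<bullet> v \<beta> = (if \<alpha> = \<beta> then 1 else 0)"
    and eigenbasis: "\<And>i \<alpha>. \<alpha> \<in> {1..n} \<Longrightarrow> M0 $ i *v v \<alpha> = lam i \<alpha> *\<^sub>R v \<alpha>"
  shows "dim S = N * (n * (n + 1) div 2) \<and>
    eigenvalues_on S L =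
      replicate_mset (n * N + n * (n - 1) div 2) 0 +
      (\<Sum>p\<in>pairs. replicate_mset (N - 1) (of_real (- gap p))) \<and>
    ((\<forall>p\<in>pairs. gap p \<noteq> 0) \<and> inj_on gap pairs \<longrightarrow>
      dim {M \<in> S. L M = 0} = n * N + n * (n - 1) div 2 \<and>
      card ((\<lambda>p. - gap p) ` pairs) = n * (n - 1) div 2 \<and>
      (\<forall>p\<in>pairs. - gap p < 0 \<and>
         count (eigenvalues_on S L) (of_real (- gap p)) = N - 1 \<and>
         dim (eigenspace_on S L (- gap p)) = N - 1) \<and>
      {c. c < 0 \<and> is_eigenvalue_on S L c} =
        (if N = 1 then {} else (\<lambda>p. - gap p) ` pairs))"
proof -
  define P where "P = {(\<alpha>, \<beta>). \<alpha> \<in> {1..CARD('n)} \<and> \<beta> \<in> {1..CARD('n)} \<and> \<alpha> \<ge> \<beta>}"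
  let ?diag = "(\<lambda>\<alpha>. (\<alpha>, \<alpha>)) ` {1..n}"
  have P: "P = pairs \<union> ?diag" "pairs \<inter> ?diag = {}"
    by (auto simp: P_def pairs_def n_def)
  have fin: "finite pairs"
    by (rule finite_subset[of _ "{1..n} \<times> {1..n}"]) (auto simp: pairs_def n_def)
  have card_pairs: "card pairs = n * (n - 1) div 2"
    unfolding pairs_def n_def by (rule card_index_pairs)
  have card_diag: "card ?diag = n" by (simp add: card_image inj_on_def)
  have N: "N \<ge> 1" by (simp add: N_def Suc_le_eq)
  obtain u W where W: "\<And>p. finite (W p)" "\<And>p. card (W p) = N" "\<And>p. u p \<in> W p"
    and basis: "orthogonal_eigenbasis (Sigma P W)
      (\<lambda>(p, w). tensor w (sym_outer (v (fst p)) (v (snd p))))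
      (\<lambda>(p, w). if w = u p then 0 else - gap p) L S"
    using linearized_flow_eigenbasis[OF symmetric orthonormal[unfolded n_def] eigenbasis[unfolded n_def]]
    unfolding P_def L_def S_def gap_def N_def by blast
  interpret orthogonal_eigenbasis "Sigma P W"
      "\<lambda>(p, w). tensor w (sym_outer (v (fst p)) (v (snd p)))"
      "\<lambda>(p, w). if w = u p then 0 else - gap p" L S
    by (rule basis)
  have finP: "finite P" using P fin by simp
  have "card P = n * (n - 1) div 2 + n"
    using P fin card_pairs card_diag by (simp add: card_Un_disjoint)
  also have "\<dots> = (n * (n - 1) + n * 2) div 2" by simp
  also have "n * (n - 1) + n * 2 = n * (n + 1)" by (cases n) simp_all
  finally have "card P = n * (n + 1) div 2" .
  then have dim: "dim S = N * (n * (n + 1) div 2)"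
    using dim_eq finP W(1,2) by (simp add: card_SigmaI)
  \<comment> \<open>One block contributes a zero along \<open>u p\<close> and \<open>- gap p\<close> along the remaining basis vectors.\<close>
  have block: "(\<Sum>w\<in>W p. {#of_real (if w = u p then 0 else - gap p)#}) =
      {#0#} + replicate_mset (N - 1) (complex_of_real (- gap p))" for p
  proof -
    have "(\<Sum>w\<in>W p - {u p}. {#of_real (if w = u p then 0 else - gap p)#}) =
        (\<Sum>w\<in>W p - {u p}. {#complex_of_real (- gap p)#})" by (rule sum.cong) auto
    also have "\<dots> = replicate_mset (N - 1) (complex_of_real (- gap p))"
      using W by (subst sum_singleton_mset_const) simp_all
    finally show ?thesis using W by (simp add: sum.remove[of "W p" "u p"])
  qed
  have "eigenvalues_on S L = (\<Sum>p\<in>P. {#0#} + replicate_mset (N - 1) (of_real (- gap p)))"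
    unfolding eigenvalues_on_eq block[symmetric]
    using finP W(1) by (subst sum.Sigma) (auto intro!: sum.cong)
  also have "\<dots> = (\<Sum>p\<in>pairs. {#0#} + replicate_mset (N - 1) (of_real (- gap p))) +
      (\<Sum>p\<in>?diag. {#0#} + replicate_mset (N - 1) (of_real (- gap p)))"
    unfolding P(1) by (rule sum.union_disjoint) (use fin P(2) in auto)
  also have "(\<Sum>p\<in>?diag. {#0#} + replicate_mset (N - 1) (complex_of_real (- gap p))) =
      (\<Sum>p\<in>?diag. replicate_mset N 0)"
    using N by (intro sum.cong) (auto simp: gap_def simp flip: replicate_mset_Suc)
  also have "\<dots> = replicate_mset (n * N) 0"
    using card_diag by (intro multiset_eqI) (simp add: count_sum)
  also have "(\<Sum>p\<in>pairs. {#0#} + replicate_mset (N - 1) (complex_of_real (- gap p))) =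
      replicate_mset (n * (n - 1) div 2) 0 +
      (\<Sum>p\<in>pairs. replicate_mset (N - 1) (of_real (- gap p)))"
    unfolding sum.distrib by (simp only: sum_singleton_mset_const[OF fin] card_pairs)
  finally have eigs: "eigenvalues_on S L = replicate_mset (n * N + n * (n - 1) div 2) 0 +
      (\<Sum>p\<in>pairs. replicate_mset (N - 1) (of_real (- gap p)))"
    by (simp add: multiset_eq_iff)
  have generic: "dim {M \<in> S. L M = 0} = n * N + n * (n - 1) div 2 \<and>
      card ((\<lambda>p. - gap p) ` pairs) = n * (n - 1) div 2 \<and>
      (\<forall>p\<in>pairs. - gap p < 0 \<and>
         count (eigenvalues_on S L) (of_real (- gap p)) = N - 1 \<and>
         dim (eigenspace_on S L (- gap p)) = N - 1) \<and>
      {c. c < 0 \<and> is_eigenvalue_on S L c} = (if N = 1 then {} else (\<lambda>p. - gap p) ` pairs)"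
    if nonzero_gap: "\<forall>p\<in>pairs. gap p \<noteq> 0" and inj_gap: "inj_on gap pairs"
  proof -
    have pos: "gap p > 0" if "p \<in> pairs" for p
    proof -
      have "gap p \<ge> 0" by (auto simp: gap_def sum_nonneg split: prod.split)
      then show ?thesis using nonzero_gap that by force
    qed
    have count0: "count (eigenvalues_on S L) (of_real 0) = n * N + n * (n - 1) div 2"
      using nonzero_gap by (simp add: eigs count_sum)
    have kernel: "{M \<in> S. L M = 0} = eigenspace_on S L 0" by (simp add: eigenspace_on_def)
    \<comment> \<open>Different pairs contribute different eigenvalues, so the multiplicity comes from one block.\<close>
    have count_gap: "count (eigenvalues_on S L) (of_real (- gap q)) = N - 1" if "q \<in> pairs" for q
    proof -
      have "count (eigenvalues_on S L) (of_real (- gap q)) =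
          (\<Sum>p\<in>pairs. if gap p = gap q then N - 1 else 0)"
        using nonzero_gap that by (auto simp: eigs count_sum intro!: sum.cong)
      also have "\<dots> = (\<Sum>p\<in>pairs. if p = q then N - 1 else 0)"
        using inj_gap that by (intro sum.cong) (auto simp: inj_on_eq_iff)
      finally show ?thesis using that fin by simp
    qed
    have "{c. c < 0 \<and> is_eigenvalue_on S L c} = (if N = 1 then {} else (\<lambda>p. - gap p) ` pairs)"
    proof -
      have "complex_of_real c \<in># eigenvalues_on S L \<longleftrightarrow> N \<noteq> 1 \<and> c \<in> (\<lambda>p. - gap p) ` pairs"
        if "c < 0" for c
        using that N fin by (auto simp: eigs set_mset_sum simp flip: of_real_minus)
      moreover have "c < 0" if "c \<in> (\<lambda>p. - gap p) ` pairs" for c using that pos by auto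
      ultimately show ?thesis by (auto simp: is_eigenvalue_on_iff)
    qed
    moreover have "card ((\<lambda>p. - gap p) ` pairs) = n * (n - 1) div 2"
      using inj_gap card_pairs by (subst card_image) (auto simp: inj_on_def)
    ultimately show ?thesis
      using pos count_gap count0 dim_eigenspace_on by (auto simp: kernel)
  qed
  show ?thesis using dim eigs generic by blast
qed

end
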